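(* Let $C$, $C'$, $P$ and $Q$ be $n\times n$ matrices. Assume that (i) $PCQ\ge PC'Q$ (entrywise); (ii) $C'$ has an eigenvector $Qu$ for $\lambda'$, for some nonnegative column vector $u=(u_1,\ldots,u_n)^T$ and $\lambda'\in\mathbb{R}$; (iii) $C$ has a left eigenvector $v^TP$ for $\lambda$, for some nonnegative row vector $v^T=(v_1,\ldots,v_n)$ and $\lambda\in\mathbb{R}$; and (iv) $v^TPQu>0$. Then $\lambda\ge\lambda'$. Moreover, $\lambda=\lambda'$ if and only if $(PC'Q)_{ij}=(PCQ)_{ij}$ for all $1\le i,j\le n$ with $v_i\ne0$ and $u_j\ne0$.
   Context: All matrices and vectors are real. "Eigenvector" means right eigenvector (so $C'Qu=\lambda'Qu$, $Qu\neq 0$), and a left eigenvector $w^T$ of $C$ for $\lambda$ satisfies $w^TC=\lambda w^T$, $w\ne0$. *)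

theory Defs
  imports "Jordan_Normal_Form.Char_Poly"
begin

(* The row vector w\<^sup>T A; row vectors are represented by the type vec, like columns. *)
definition vec_mult_mat :: "'a :: comm_ring_1 vec \<Rightarrow> 'a mat \<Rightarrow> 'a vec" (infixl "\<^sub>v*" 70) where
  "w \<^sub>v* A = vec (dim_col A) (\<lambda>j. w \<bullet> col A j)"

definition left_eigenvector :: "'a :: comm_ring_1 mat \<Rightarrow> 'a vec \<Rightarrow> 'a \<Rightarrow> bool" where
  "left_eigenvector A w k =
    (w \<in> carrier_vec (dim_row A) \<and> w \<noteq> 0\<^sub>v (dim_row A) \<and> w \<^sub>v* A = k \<cdot>\<^sub>v w)"

lemma vec_mult_mat_transpose:
  assumes "A \<in> carrier_mat nr nc" "w \<in> carrier_vec nr"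
  shows "w \<^sub>v* A = transpose_mat A *\<^sub>v w"
  using assms by (intro eq_vecI) (auto simp: vec_mult_mat_def comm_scalar_prod[of _ nr])

end

theory Submission
  imports Defs
begin

text \<open>Evaluating \<open>v\<^sup>T P C Q u\<close> with the left eigenvector and \<open>v\<^sup>T P C' Q u\<close> with the right
  eigenvector gives \<open>(\<lambda> - \<lambda>') v\<^sup>T P Q u = \<Sum>\<^sub>i\<^sub>j v\<^sub>i (PCQ - PC'Q)\<^sub>i\<^sub>j u\<^sub>j\<close>, a sum of nonnegative terms; since
  \<open>v\<^sup>T P Q u > 0\<close>, its sign and its vanishing are those of \<open>\<lambda> - \<lambda>'\<close>.\<close>

text \<open>Transposition lets a matrix pass from one side of the scalar product to the other; this
  brings \<open>C\<close> next to the row vector \<open>v \<^sub>v* P\<close>, where the left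
  eigenvector equation applies.\<close>

lemma vec_mult_mat_scalar_prod:
  assumes "A \<in> carrier_mat nr nc" "w \<in> carrier_vec nr" "x \<in> carrier_vec nc"
  shows "(w \<^sub>v* A) \<bullet> x = w \<bullet> (A *\<^sub>v x)"
  using assms transpose_vec_mult_scalar[of A nr nc x w]
  by (simp add: vec_mult_mat_transpose)

text \<open>A single sum over index pairs, rather than a nested one, lets one vanishing criterion
  for nonnegative sums reach every matrix entry at once.\<close>

lemma scalar_prod_mult_mat_vec_sum:
  assumes "A \<in> carrier_mat nr nc" "w \<in> carrier_vec nr" "x \<in> carrier_vec nc"
  shows "w \<bullet> (A *\<^sub>v x) = (\<Sum>(i, j)\<in>{0..<nr} \<times> {0..<nc}. w $ i * A $$ (i, j) * x $ j)"
proof -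
  have "w \<bullet> (A *\<^sub>v x) = (\<Sum>i\<in>{0..<nr}. \<Sum>j\<in>{0..<nc}. w $ i * A $$ (i, j) * x $ j)"
    using assms by (simp add: scalar_prod_def sum_distrib_left mult.assoc)
  then show ?thesis by (simp add: sum.cartesian_product)
qed

theorem lemma3p2:
  fixes C C' P Q :: "real mat" and u v :: "real vec" and l l' :: real and n :: nat
  assumes C: "C \<in> carrier_mat n n" and C': "C' \<in> carrier_mat n n"
    and P: "P \<in> carrier_mat n n" and Q: "Q \<in> carrier_mat n n"
    and u: "u \<in> carrier_vec n" and u_nonneg: "0\<^sub>v n \<le> u"
    and v: "v \<in> carrier_vec n" and v_nonneg: "0\<^sub>v n \<le> v"
    and i: "P * C * Q \<ge> P * C' * Q"
    and ii: "eigenvector C' (Q *\<^sub>v u) l'"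
    and iii: "left_eigenvector C (v \<^sub>v* P) l"
    and iv: "v \<bullet> ((P * Q) *\<^sub>v u) > 0"
  shows "l \<ge> l' \<and>
    (l = l' \<longleftrightarrow>
      (\<forall>i<n. \<forall>j<n. v $ i \<noteq> 0 \<and> u $ j \<noteq> 0 \<longrightarrow>
        (P * C' * Q) $$ (i, j) = (P * C * Q) $$ (i, j)))"
proof -
  define s where "s = v \<bullet> ((P * Q) *\<^sub>v u)"
  define D where "D i j = (P * C * Q) $$ (i, j) - (P * C' * Q) $$ (i, j)" for i j
  define f where "f = (\<lambda>(i, j). v $ i * D i j * u $ j)"
  have s_pos: "s > 0" using iv by (simp add: s_def)
  have Qu: "Q *\<^sub>v u \<in> carrier_vec n" using Q u by simp
  have vP: "v \<^sub>v* P \<in> carrier_vec n" using P by (simp add: vec_mult_mat_def)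
  have s: "v \<bullet> (P *\<^sub>v (Q *\<^sub>v u)) = s"
    using P Q u by (simp add: s_def assoc_mult_mat_vec[of P n n Q n])
  have "v \<bullet> ((P * C * Q) *\<^sub>v u) = v \<bullet> (P *\<^sub>v (C *\<^sub>v (Q *\<^sub>v u)))"
    using P C Q u Qu by (simp add: assoc_mult_mat_vec[of _ n n _ n])
  also have "\<dots> = ((v \<^sub>v* P) \<^sub>v* C) \<bullet> (Q *\<^sub>v u)"
    using P C Qu v vP by (simp add: vec_mult_mat_scalar_prod[of _ n n])
  \<comment> \<open>The eigenvector equation releases the factor \<open>l\<close>; then
    \<open>P\<close> moves back to the right, leaving the form of \<open>s\<close> bracketed as in
    fact \<open>s\<close>.\<close>
  also have "\<dots> = l * s"
    using iii P Qu v vP s by (simp add: left_eigenvector_def vec_mult_mat_scalar_prod[of _ n n])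
  finally have PCQ: "v \<bullet> ((P * C * Q) *\<^sub>v u) = l * s" .
  have "v \<bullet> ((P * C' * Q) *\<^sub>v u) = v \<bullet> (P *\<^sub>v (C' *\<^sub>v (Q *\<^sub>v u)))"
    using P C' Q u Qu by (simp add: assoc_mult_mat_vec[of _ n n _ n])
  \<comment> \<open>Here \<open>C'\<close> already acts on its eigenvector, and \<open>l'\<close>
    passes through \<open>P\<close> by linearity.\<close>
  also have "\<dots> = l' * s"
    using ii P Qu v s by (simp add: eigenvector_def mult_mat_vec[of _ n n])
  finally have PC'Q: "v \<bullet> ((P * C' * Q) *\<^sub>v u) = l' * s" .
  have "(l - l') * s = v \<bullet> ((P * C * Q) *\<^sub>v u) - v \<bullet> ((P * C' * Q) *\<^sub>v u)"
    by (simp only: PCQ PC'Q left_diff_distrib)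
  also have "\<dots> = sum f ({0..<n} \<times> {0..<n})"
    using P C C' Q u v
    by (simp add: scalar_prod_mult_mat_vec_sum[of _ n n] f_def D_def right_diff_distrib
        left_diff_distrib split_def flip: sum_subtractf)
  finally have sum_f: "(l - l') * s = sum f ({0..<n} \<times> {0..<n})" .
  have D_nonneg: "D i j \<ge> 0" if "i < n" "j < n" for i j
    using i that P Q by (simp add: D_def less_eq_mat_def)
  have f_nonneg: "f x \<ge> 0" if "x \<in> {0..<n} \<times> {0..<n}" for x
    using that u_nonneg v_nonneg u v D_nonneg by (auto simp: f_def less_eq_vec_def)
  \<comment> \<open>A real product vanishes iff one of its factors does; the implication is this
    three-way disjunction rewritten.\<close>
  have f_eq_0: "f (i, j) = 0 \<longleftrightarrow> (v $ i \<noteq> 0 \<and> u $ j \<noteq> 0 \<longrightarrow>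
        (P * C' * Q) $$ (i, j) = (P * C * Q) $$ (i, j))" for i j
    by (auto simp: f_def D_def)
  have "(l - l') * s \<ge> 0" using f_nonneg by (simp only: sum_f sum_nonneg)
  then have "l' \<le> l" using s_pos by (simp add: zero_le_mult_iff)
  \<comment> \<open>The sum is folded back into \<open>(l - l') * s\<close>, where \<open>s\<close>
    can be cancelled because it is nonzero.\<close>
  have "l = l' \<longleftrightarrow> sum f ({0..<n} \<times> {0..<n}) = 0"
    using s_pos by (simp flip: sum_f)
  also have "\<dots> \<longleftrightarrow> (\<forall>x\<in>{0..<n} \<times> {0..<n}. f x = 0)"
    by (rule sum_nonneg_eq_0_iff) (use f_nonneg in auto)
  also have "\<dots> \<longleftrightarrow> (\<forall>i<n. \<forall>j<n. f (i, j) = 0)"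
    by auto
  finally show ?thesis using \<open>l' \<le> l\<close> by (simp only: f_eq_0 simp_thms)
qed

end
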